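(* Consider a tenable balanced two-colour urn with multiple drawings (sample size $m\ge 1$), and suppose we are given the numbers $a_{m-1}$ and $a_m$, and the balance factor $\sigma=a_k+b_k\ge 0$ ($0\le k\le m$). For both sampling schemes (model $\mathcal M$ and model $\mathcal R$), the random variable $W_n$, the number of white balls after $n$ draws, satisfies a linear affine relation of the form $$\mathbb E[W_n\mid\mathbb F_{n-1}]=\alpha_n W_{n-1}+\beta_n,\qquad n\ge 1,$$ with certain deterministic sequences $\alpha_n,\beta_n$, if and only if, for $0\le k\le m$, the numbers $a_k$ satisfy the condition $$a_k=(m-k)a_{m-1}-(m-k-1)a_m.$$ Equivalently, the coefficients $a_k$ themselves satisfy an affinity condition $$a_k=a_0+hk,\qquad 0\le k\le m,$$ with $h$ (where $h=\frac{a_m-a_0}{m}$) an integer guaranteeing tenability. The sequences $\alpha_n$ and $\beta_n$ are given in terms of $a_{m-1}$, $a_m$ and $T_n$ by $$\alpha_n=\frac{T_{n-1}+m(a_{m-1}-a_m)}{T_{n-1}},\qquad \beta_n=a_m,\qquad n\ge 1.$$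
   Context: Urn setting. Let $m\ge1$ be an integer (sample size), and let $a_k,b_k$ ($0\le k\le m$) be integers with $a_k+b_k=\sigma$ for all $k$ (the urn is balanced). The urn starts with $W_0,B_0\in\mathbb N_0$ white and black balls, $W_0+B_0\ge m$. At step $n\ge1$ a sample of $m$ balls is drawn from the urn, which contains $W_{n-1}$ white and $B_{n-1}$ black balls; the sample is returned, and if it contained $k$ white and $m-k$ black balls, then $a_{m-k}$ white and $b_{m-k}$ black balls are added (negative numbers mean removal). The total number of balls after $n$ draws is deterministic: $T_n=W_n+B_n=T_0+\sigma n$. $\mathbb F_n$ is the $\sigma$-field generated by the first $n$ draws. Sampling models. Given $\mathbb F_{n-1}$, the probability that the $n$-th sample contains exactly $k$ white balls ($0\le k\le m$) is $\binom{W_{n-1}}{k}\binom{T_{n-1}-W_{n-1}}{m-k}\big/\binom{T_{n-1}}{m}$ in model $\mathcal M$ (sampling without replacement) and $\binom mk W_{n-1}^k(T_{n-1}-W_{n-1})^{m-k}/T_{n-1}^m$ in model $\mathcal R$ (sampling with replacement). Tenability means that the process of drawing and replacing balls can be continued ad infinitum.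
   Formalization: "Only if" fails for some starts (W_0=0, a_m=0), so it is proved when some W_n takes more than m values, or when the relation holds with common α_n, β_n from every tenable start of T_0 balls; α_n, β_n are shown unique only where W_{n-1} is not a.s. constant. *)

theory Defs
  imports "HOL-Probability.Probability"
begin

datatype sampling_model = Without_Replacement | With_Replacement

text \<open>Probability that a sample of size \<open>m\<close> from \<open>w\<close> white and \<open>v\<close> black balls contains
  exactly \<open>k\<close> white ones.\<close>

fun sample_prob :: "sampling_model \<Rightarrow> nat \<Rightarrow> nat \<Rightarrow> nat \<Rightarrow> nat \<Rightarrow> real" where
  "sample_prob Without_Replacement m w v k =
     real (w choose k) * real (v choose (m - k)) / real ((w + v) choose m)"
| "sample_prob With_Replacement m w v k =
     real (m choose k) * real w ^ k * real v ^ (m - k) / real (w + v) ^ m"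

text \<open>Compositions (white, black) that the urn attains with positive probability. They are kept
  as integers, so that a replacement that removes too many balls shows up as a negative entry.\<close>

inductive reachable ::
  "sampling_model \<Rightarrow> nat \<Rightarrow> (nat \<Rightarrow> int) \<Rightarrow> (nat \<Rightarrow> int) \<Rightarrow> nat \<Rightarrow> nat \<Rightarrow> int \<Rightarrow> int \<Rightarrow> bool"
  for md :: sampling_model and m :: nat and a b :: "nat \<Rightarrow> int" and W0 B0 :: nat where
  init: "reachable md m a b W0 B0 (int W0) (int B0)"
| draw: "reachable md m a b W0 B0 w v \<Longrightarrow> k \<le> m \<Longrightarrow> sample_prob md m (nat w) (nat v) k > 0 \<Longrightarrow>
     reachable md m a b W0 B0 (w + a (m - k)) (v + b (m - k))"

text \<open>The condition \<open>int m \<le> w + v\<close> (a sample can be drawn) is automatic for a balanced urn with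
  \<open>\<sigma> \<ge> 0\<close> and \<open>W0 + B0 \<ge> m\<close>.\<close>

definition tenable ::
  "sampling_model \<Rightarrow> nat \<Rightarrow> (nat \<Rightarrow> int) \<Rightarrow> (nat \<Rightarrow> int) \<Rightarrow> nat \<Rightarrow> nat \<Rightarrow> bool" where
  "tenable md m a b W0 B0 \<longleftrightarrow>
     (\<forall>w v. reachable md m a b W0 B0 w v \<longrightarrow> 0 \<le> w \<and> 0 \<le> v \<and> int m \<le> w + v)"

text \<open>In what follows \<open>K n \<omega>\<close> is the number of white balls in the \<open>n\<close>-th sample, \<open>n \<ge> 1\<close>
  (\<open>K 0\<close> is not used). The number of balls of one colour evolves by adding \<open>c (m - k)\<close> balls after a
  sample with \<open>k\<close> white balls: take \<open>c = a\<close>, \<open>x0 = W0\<close> for white and \<open>c = b\<close>, \<open>x0 = B0\<close> for black.\<close>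

primrec balls ::
  "nat \<Rightarrow> (nat \<Rightarrow> int) \<Rightarrow> nat \<Rightarrow> (nat \<Rightarrow> 'a \<Rightarrow> nat) \<Rightarrow> nat \<Rightarrow> 'a \<Rightarrow> int" where
  "balls m c x0 K 0 \<omega> = int x0"
| "balls m c x0 K (Suc n) \<omega> = balls m c x0 K n \<omega> + c (m - K (Suc n) \<omega>)"

definition draw_field :: "'a measure \<Rightarrow> (nat \<Rightarrow> 'a \<Rightarrow> nat) \<Rightarrow> nat \<Rightarrow> 'a measure" where
  "draw_field M K n = sigma (space M) {K i -` A \<inter> space M | i A. 1 \<le> i \<and> i \<le> n}"

locale urn_process = prob_space M
  for md :: sampling_model and m :: nat and a b :: "nat \<Rightarrow> int" and W0 B0 :: nat
    and M :: "'a measure" and K :: "nat \<Rightarrow> 'a \<Rightarrow> nat" +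
  assumes sample_measurable: "n \<ge> 1 \<Longrightarrow> K n \<in> measurable M (count_space UNIV)"
    and sample_le: "n \<ge> 1 \<Longrightarrow> \<omega> \<in> space M \<Longrightarrow> K n \<omega> \<le> m"
    and sample_law: "n \<ge> 1 \<Longrightarrow> k \<le> m \<Longrightarrow>
      AE \<omega> in M. real_cond_exp M (draw_field M K (n - 1)) (indicat_real {\<omega> \<in> space M. K n \<omega> = k}) \<omega>
        = sample_prob md m (nat (balls m a W0 K (n - 1) \<omega>)) (nat (balls m b B0 K (n - 1) \<omega>)) k"

definition affine_recursion ::
  "nat \<Rightarrow> (nat \<Rightarrow> int) \<Rightarrow> nat \<Rightarrow> 'a measure \<Rightarrow> (nat \<Rightarrow> 'a \<Rightarrow> nat) \<Rightarrow>
     (nat \<Rightarrow> real) \<Rightarrow> (nat \<Rightarrow> real) \<Rightarrow> bool" where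
  "affine_recursion m a W0 M K \<alpha> \<beta> \<longleftrightarrow>
     (\<forall>n\<ge>1. AE \<omega> in M.
        real_cond_exp M (draw_field M K (n - 1)) (\<lambda>\<omega>. real_of_int (balls m a W0 K n \<omega>)) \<omega>
          = \<alpha> n * real_of_int (balls m a W0 K (n - 1) \<omega>) + \<beta> n)"

definition white_values ::
  "nat \<Rightarrow> (nat \<Rightarrow> int) \<Rightarrow> nat \<Rightarrow> 'a measure \<Rightarrow> (nat \<Rightarrow> 'a \<Rightarrow> nat) \<Rightarrow> nat \<Rightarrow> int set" where
  "white_values m a W0 M K n = {w. measure M {\<omega> \<in> space M. balls m a W0 K n \<omega> = w} > 0}"

definition affine_condition :: "nat \<Rightarrow> (nat \<Rightarrow> int) \<Rightarrow> bool" where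
  "affine_condition m a \<longleftrightarrow>
     (\<forall>k\<le>m. a k = (int m - int k) * a (m - 1) - (int m - int k - 1) * a m)"

definition total_balls :: "int \<Rightarrow> nat \<Rightarrow> nat \<Rightarrow> real" where
  "total_balls \<sigma> T0 n = real T0 + real_of_int \<sigma> * real n"

definition affine_slope :: "nat \<Rightarrow> (nat \<Rightarrow> int) \<Rightarrow> int \<Rightarrow> nat \<Rightarrow> nat \<Rightarrow> real" where
  "affine_slope m a \<sigma> T0 n =
     (total_balls \<sigma> T0 (n - 1) + real m * real_of_int (a (m - 1) - a m)) / total_balls \<sigma> T0 (n - 1)"

end

theory Submission
  imports Defs
begin

text \<open>Conditionally on the past, \<open>W\<close> grows by the drift \<open>\<Sum>k\<le>m. a (m - k) * p w k\<close>, where \<open>p w k\<close> is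
  the sampling probability. In both models the mean number of white balls in the sample is
  \<open>m * w / T\<close>, so an affine sequence \<open>a\<close> has a drift affine in \<open>w\<close>. Conversely, the functions
  \<open>p _ k\<close>, \<open>k \<le> m\<close>, are linearly independent polynomials in \<open>w\<close> of degree at most \<open>m\<close>; hence a
  drift that is affine at more than \<open>m\<close> values of \<open>w\<close> comes from an affine sequence only.\<close>

section \<open>Total mass and mean of the sampling distribution\<close>

lemma sample_prob_nonneg: "0 \<le> sample_prob md m w v k"
  by (cases md) auto

lemma sum_sample_prob:
  assumes "m \<le> w + v" "0 < w + v"
  shows "(\<Sum>k\<le>m. sample_prob md m w v k) = 1"
proof (cases md)
  case Without_Replacement
  have "(\<Sum>k\<le>m. real (w choose k) * real (v choose (m - k))) = real ((w + v) choose m)"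
    by (simp flip: vandermonde)
  then show ?thesis
    using assms Without_Replacement by (simp flip: sum_divide_distrib)
next
  case With_Replacement
  have "(\<Sum>k\<le>m. real (m choose k) * real w ^ k * real v ^ (m - k)) = (real w + real v) ^ m"
    by (simp add: binomial_ring)
  then show ?thesis
    using assms With_Replacement by (simp flip: sum_divide_distrib)
qed

text \<open>Absorption trades the factor \<open>k\<close> for a sample that is smaller by one:
  \<open>k * (w choose k)\<close> becomes \<open>w * (w - 1 choose k - 1)\<close> in one model,
  \<open>k * (Suc m choose k)\<close> becomes \<open>Suc m * (m choose k - 1)\<close> in the other.
  What remains is summed by Vandermonde or by the binomial theorem. The successor form lets the
  index shift drop the vanishing term \<open>k = 0\<close>.\<close>

lemma sample_prob_mean_Suc:
  fixes m w v :: nat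
  assumes "Suc m \<le> w + v"
  shows "(\<Sum>k\<le>Suc m. real k * sample_prob md (Suc m) w v k) = real (Suc m) * real w / real (w + v)"
proof (cases md)
  case Without_Replacement
  have "(\<Sum>k\<le>Suc m. k * ((w choose k) * (v choose (Suc m - k))))
      = (\<Sum>k\<le>m. Suc k * (w choose Suc k) * (v choose (m - k)))"
    by (subst sum.atMost_Suc_shift) (simp add: mult.assoc del: mult_Suc)
  also have "\<dots> = w * (\<Sum>k\<le>m. ((w - 1) choose k) * (v choose (m - k)))"
    by (simp add: binomial_absorption sum_distrib_left mult.assoc del: mult_Suc)
  also have "\<dots> = w * ((w - 1 + v) choose m)"
    by (simp add: vandermonde)
  \<comment> \<open>For \<open>w = 0\<close> the truncated differences may disagree, but then the
    factor \<open>w\<close> annihilates both sides.\<close>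
  also have "\<dots> = w * ((w + v - 1) choose m)"
    by (cases w) auto
  \<comment> \<open>The factor \<open>w + v\<close> prepares a second absorption, which produces the
    denominator \<open>(w + v) choose Suc m\<close>; the argument thus stays division-free in the
    naturals.\<close>
  finally have "(w + v) * (\<Sum>k\<le>Suc m. k * ((w choose k) * (v choose (Suc m - k))))
      = w * ((w + v) * ((w + v - 1) choose m))"
    by simp
  also have "\<dots> = w * (Suc m * ((w + v) choose Suc m))"
    by (simp only: binomial_absorption)
  finally have "real ((w + v) * (\<Sum>k\<le>Suc m. k * ((w choose k) * (v choose (Suc m - k)))))
      = real (w * (Suc m * ((w + v) choose Suc m)))"
    by (simp only:)
  then have "real (w + v) * (\<Sum>k\<le>Suc m. real k * (real (w choose k) * real (v choose (Suc m - k))))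
      = real w * (real (Suc m) * real ((w + v) choose Suc m))"
    by (simp only: of_nat_mult of_nat_sum)
  moreover have "real ((w + v) choose Suc m) > 0" "real (w + v) > 0"
    using assms by (auto simp del: of_nat_add binomial_Suc_Suc)
  moreover have "(\<Sum>k\<le>Suc m. real k * sample_prob md (Suc m) w v k)
     = (\<Sum>k\<le>Suc m. real k * (real (w choose k) * real (v choose (Suc m - k)))) / real ((w + v) choose Suc m)"
    unfolding sum_divide_distrib using Without_Replacement by (intro sum.cong) auto
  ultimately show ?thesis
    by (simp add: frac_eq_eq mult_ac del: of_nat_add binomial_Suc_Suc sum.atMost_Suc of_nat_Suc)
next
  case With_Replacement
  have "(\<Sum>k\<le>Suc m. real k * (real (Suc m choose k) * real w ^ k * real v ^ (Suc m - k)))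
      = (\<Sum>k\<le>m. real (Suc k * (Suc m choose Suc k)) * real w ^ Suc k * real v ^ (m - k))"
    by (subst sum.atMost_Suc_shift) (simp add: mult.assoc del: mult_Suc binomial_Suc_Suc)
  also have "\<dots> = (\<Sum>k\<le>m. real (Suc m) * real w * (real (m choose k) * real w ^ k * real v ^ (m - k)))"
    unfolding Suc_times_binomial by (intro sum.cong) (simp_all only: of_nat_mult power_Suc mult_ac)
  also have "\<dots> = real (Suc m) * real w * real (w + v) ^ m"
    by (simp add: binomial_ring flip: sum_distrib_left)
  finally have *: "(\<Sum>k\<le>Suc m. real k * (real (Suc m choose k) * real w ^ k * real v ^ (Suc m - k)))
      = real (Suc m) * real w * real (w + v) ^ m" .
  have "(\<Sum>k\<le>Suc m. real k * sample_prob md (Suc m) w v k)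
     = (\<Sum>k\<le>Suc m. real k * (real (Suc m choose k) * real w ^ k * real v ^ (Suc m - k))) / real (w + v) ^ Suc m"
    unfolding sum_divide_distrib using With_Replacement by (intro sum.cong) auto
  also have "\<dots> = real (Suc m) * real w / real (w + v)"
    unfolding * using assms by (simp del: of_nat_add of_nat_Suc)
  finally show ?thesis .
qed

lemma sample_prob_mean:
  assumes "m \<le> w + v" "0 < w + v"
  shows "(\<Sum>k\<le>m. real k * sample_prob md m w v k) = real m * real w / real (w + v)"
  using assms sample_prob_mean_Suc[of "m - 1" w v md] by (cases m) auto

section \<open>Linear independence of the sampling probabilities as functions of
  \<open>w\<close>\<close>

lemma poly_eq_0_if_many_nat_roots:
  fixes p :: "real poly"
  assumes "degree p < card S" and roots: "\<And>w. w \<in> S \<Longrightarrow> poly p (real w) = 0"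
  shows "p = 0"
proof (rule ccontr)
  assume "p \<noteq> 0"
  have "card S = card (real ` S)"
    by (simp add: card_image)
  also have "\<dots> \<le> card {x. poly p x = 0}"
    using poly_roots_finite[OF \<open>p \<noteq> 0\<close>] roots by (intro card_mono) auto
  also have "\<dots> \<le> degree p"
    by (rule card_poly_roots_bound[OF \<open>p \<noteq> 0\<close>])
  finally show False
    using assms(1) by simp
qed

text \<open>The binomial coefficient as a formal polynomial in its upper argument, so that degrees
  and roots can be counted.\<close>

definition gbinomial_poly :: "nat \<Rightarrow> real poly" where
  "gbinomial_poly k = smult (1 / fact k) (\<Prod>i<k. [:- real i, 1:])"

lemma poly_gbinomial_poly: "poly (gbinomial_poly k) x = x gchoose k"
  by (simp add: gbinomial_poly_def poly_prod gbinomial_prod_rev atLeast0LessThan)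

lemma degree_gbinomial_poly: "degree (gbinomial_poly k) \<le> k"
proof -
  have "degree (\<Prod>i<k. [:- real i, 1:]) \<le> (\<Sum>i<k. degree [:- real i, 1:])"
    using degree_prod_sum_le[of "{..<k}" "\<lambda>i. [:- real i, 1:]"] by (simp add: o_def)
  then show ?thesis
    by (simp add: gbinomial_poly_def)
qed

text \<open>The sum is a polynomial in \<open>w\<close> of degree at most \<open>m\<close>, so more
  than \<open>m\<close> zeros force it to vanish at every \<open>w \<le> T\<close>. There the system
  is triangular: at \<open>w = k\<close> the terms \<open>j > k\<close> contain
  \<open>k choose j = 0\<close>, those with \<open>j < k\<close> vanish by induction, and the
  diagonal factor \<open>(T - k) choose (m - k)\<close> is nonzero because
  \<open>m \<le> T\<close>.\<close>

lemma hypergeometric_independent: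
  fixes d :: "nat \<Rightarrow> real"
  assumes "m \<le> T" and S: "S \<subseteq> {..T}" "m < card S"
    and zero: "\<And>w. w \<in> S \<Longrightarrow> (\<Sum>k\<le>m. d k * (real (w choose k) * real ((T - w) choose (m - k)))) = 0"
    and "k \<le> m"
  shows "d k = 0"
proof -
  define P where "P = (\<Sum>k\<le>m. smult (d k) (gbinomial_poly k * pcompose (gbinomial_poly (m - k)) [:real T, -1:]))"
  \<comment> \<open>The bound \<open>w \<le> T\<close> matters: only there is the truncated
    \<open>T - w\<close> the value of the polynomial \<open>[:real T, -1:]\<close>.\<close>
  have P: "poly P (real w) = (\<Sum>k\<le>m. d k * (real (w choose k) * real ((T - w) choose (m - k))))"
    if "w \<le> T" for w
    using that by (simp add: P_def poly_sum poly_pcompose poly_gbinomial_poly binomial_gbinomial of_nat_diff)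
  have "degree P \<le> m"
    unfolding P_def
  proof (rule degree_sum_le)
    fix j assume "j \<in> {..m}"
    have "degree (gbinomial_poly j * pcompose (gbinomial_poly (m - j)) [:real T, -1:])
        \<le> degree (gbinomial_poly j) + degree (pcompose (gbinomial_poly (m - j)) [:real T, -1:])"
      by (rule degree_mult_le)
    also have "\<dots> \<le> j + (m - j)"
      using degree_gbinomial_poly by (simp add: degree_pcompose add_mono)
    finally show "degree (smult (d j) (gbinomial_poly j * pcompose (gbinomial_poly (m - j)) [:real T, -1:])) \<le> m"
      using \<open>j \<in> {..m}\<close> by simp
  qed simp
  then have "P = 0"
    using S P zero by (intro poly_eq_0_if_many_nat_roots[of P S]) auto
  then have all: "(\<Sum>k\<le>m. d k * (real (w choose k) * real ((T - w) choose (m - k)))) = 0" if "w \<le> T" for w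
    using P[OF that] by simp
  show ?thesis
    using \<open>k \<le> m\<close>
  proof (induction k rule: less_induct)
    case (less k)
    have "d j * (real (k choose j) * real ((T - k) choose (m - j)))
        = (if j = k then d k * real ((T - k) choose (m - k)) else 0)" if "j \<le> m" for j
      using less that by (cases j k rule: linorder_cases) auto
    then have "(\<Sum>j\<le>m. d j * (real (k choose j) * real ((T - k) choose (m - j))))
        = (\<Sum>j\<le>m. if j = k then d k * real ((T - k) choose (m - k)) else 0)"
      by (intro sum.cong) auto
    then have "d k * real ((T - k) choose (m - k)) = 0"
      using all[of k] less.prems \<open>m \<le> T\<close> by simp
    then show ?case
      using less.prems \<open>m \<le> T\<close> by auto
  qed
qed

text \<open>Root counting again makes the polynomial vanish identically. Each term is homogeneous of
  degree \<open>m\<close> in \<open>x\<close> and \<open>T - x\<close>, so only the ratio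
  \<open>y = x / (T - x)\<close> matters, and in \<open>y\<close> the coefficients
  \<open>d k * (m choose k)\<close> can be read off one by one.\<close>

lemma bernstein_independent:
  fixes d :: "nat \<Rightarrow> real"
  assumes "0 < T" and S: "S \<subseteq> {..T}" "m < card S"
    and zero: "\<And>w. w \<in> S \<Longrightarrow> (\<Sum>k\<le>m. d k * (real (m choose k) * real w ^ k * real (T - w) ^ (m - k))) = 0"
    and "k \<le> m"
  shows "d k = 0"
proof -
  define P where "P = (\<Sum>k\<le>m. smult (d k * real (m choose k)) ([:0, 1:] ^ k * [:real T, -1:] ^ (m - k)))"
  have P: "poly P x = (\<Sum>k\<le>m. d k * real (m choose k) * (x ^ k * (real T - x) ^ (m - k)))" for x
    by (simp add: P_def poly_sum poly_power)
  have "degree P \<le> m"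
    unfolding P_def
  proof (rule degree_sum_le)
    fix j assume "j \<in> {..m}"
    have "degree ([:0, 1::real:] ^ j * [:real T, -1:] ^ (m - j))
        \<le> degree ([:0, 1::real:] ^ j) + degree ([:real T, -1:] ^ (m - j))"
      by (rule degree_mult_le)
    also have "\<dots> \<le> j + (m - j)"
      by (intro add_mono order.trans[OF degree_power_le]) auto
    finally show "degree (smult (d j * real (m choose j)) ([:0, 1:] ^ j * [:real T, -1:] ^ (m - j))) \<le> m"
      using \<open>j \<in> {..m}\<close> by simp
  qed simp
  moreover have "poly P (real w) = 0" if "w \<in> S" for w
    using zero[OF that] that S by (auto simp: P of_nat_diff mult.assoc subset_iff)
  ultimately have "P = 0"
    using S by (intro poly_eq_0_if_many_nat_roots[of P S]) auto
  \<comment> \<open>The substitution \<open>x = T y / (1 + y)\<close> turns the Bernstein basis into the monomials in \<open>y\<close>.\<close>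
  define Q where "Q = (\<Sum>k\<le>m. monom (d k * real (m choose k)) k)"
  have "poly Q y = 0" if "y > 0" for y
  proof -
    define c where "c = real T / (1 + y)"
    have "c > 0"
      using \<open>0 < T\<close> that by (simp add: c_def)
    have "real T - c * y = c"
      using that by (simp add: c_def field_simps)
    then have "0 = (\<Sum>k\<le>m. d k * real (m choose k) * ((c * y) ^ k * c ^ (m - k)))"
      using P[of "c * y"] \<open>P = 0\<close> by simp
    also have "\<dots> = (\<Sum>k\<le>m. c ^ m * (d k * real (m choose k) * y ^ k))"
    proof (rule sum.cong)
      fix k assume "k \<in> {..m}"
      then have "c ^ m = c ^ k * c ^ (m - k)"
        by (simp flip: power_add)
      then show "d k * real (m choose k) * ((c * y) ^ k * c ^ (m - k)) = c ^ m * (d k * real (m choose k) * y ^ k)"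
        by (simp add: power_mult_distrib)
    qed simp
    also have "\<dots> = c ^ m * poly Q y"
      by (simp add: Q_def poly_sum poly_monom sum_distrib_left)
    finally show ?thesis
      using \<open>c > 0\<close> by simp
  qed
  \<comment> \<open>\<open>Q\<close> vanishes at all positive reals; one more positive integer than
    its degree suffices.\<close>
  then have "poly Q (real w) = 0" if "w \<in> {1..Suc (degree Q)}" for w
    using that by simp
  then have "Q = 0"
    by (intro poly_eq_0_if_many_nat_roots[of Q "{1..Suc (degree Q)}"]) auto
  moreover have "coeff Q k = d k * real (m choose k)"
    using \<open>k \<le> m\<close> by (simp add: Q_def coeff_sum)
  ultimately show ?thesis
    using \<open>k \<le> m\<close> by simp
qed

text \<open>For a fixed total \<open>T\<close> the denominators in both models are positive
  constants independent of \<open>w\<close>, so they cancel.\<close>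

lemma sample_prob_independent:
  fixes d :: "nat \<Rightarrow> real"
  assumes "m \<le> T" "0 < T" "S \<subseteq> {..T}" "m < card S"
    and zero: "\<And>w. w \<in> S \<Longrightarrow> (\<Sum>k\<le>m. d k * sample_prob md m w (T - w) k) = 0"
    and "k \<le> m"
  shows "d k = 0"
proof (cases md)
  case Without_Replacement
  have "(\<Sum>k\<le>m. d k * (real (w choose k) * real ((T - w) choose (m - k)))) = 0" if "w \<in> S" for w
    using zero[OF that] that assms Without_Replacement
    by (auto simp: subset_iff simp flip: sum_divide_distrib)
  then show ?thesis
    by (rule hypergeometric_independent[OF assms(1,3,4) _ assms(6)])
next
  case With_Replacement
  have "(\<Sum>k\<le>m. d k * (real (m choose k) * real w ^ k * real (T - w) ^ (m - k))) = 0" if "w \<in> S" for w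
    using zero[OF that] that assms With_Replacement
    by (auto simp: subset_iff simp flip: sum_divide_distrib of_nat_add)
  then show ?thesis
    by (rule bernstein_independent[OF assms(2,3,4) _ assms(6)])
qed

section \<open>Forms of the affinity condition, and the drift it produces\<close>

lemma affine_condition_of_int:
  assumes "affine_condition m a" "k \<le> m"
  shows "real_of_int (a (m - k)) = real_of_int (a m) + real_of_int (a (m - 1) - a m) * real k"
proof -
  have "a (m - k) = (int m - int (m - k)) * a (m - 1) - (int m - int (m - k) - 1) * a m"
    using assms unfolding affine_condition_def by (metis diff_le_self)
  also have "\<dots> = a m + (a (m - 1) - a m) * int k"
    using assms(2) by (simp add: algebra_simps)
  finally show ?thesis
    by simp
qed

text \<open>A sample with \<open>k\<close> white balls triggers \<open>a (m - k)\<close>, so the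
  sequence is read from the top. The values at \<open>k = 0\<close> and \<open>k = 1\<close> force
  \<open>c = a m\<close> and \<open>c + d = a (m - 1)\<close>, hence arbitrary real coefficients
  allow no more than the integer condition.\<close>

lemma affine_condition_iff_real:
  assumes "m \<ge> 1"
  shows "affine_condition m a \<longleftrightarrow>
    (\<exists>c d :: real. \<forall>k\<le>m. real_of_int (a (m - k)) = c + d * real k)"
proof
  assume a: "affine_condition m a"
  show "\<exists>c d :: real. \<forall>k\<le>m. real_of_int (a (m - k)) = c + d * real k"
    using affine_condition_of_int[OF a] by blast
next
  assume "\<exists>c d :: real. \<forall>k\<le>m. real_of_int (a (m - k)) = c + d * real k"
  then obtain c d where *: "\<And>k. k \<le> m \<Longrightarrow> real_of_int (a (m - k)) = c + d * real k"
    by blast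
  have "real_of_int (a m) = c" "real_of_int (a (m - 1)) = c + d"
    using *[of 0] *[of 1] assms by simp_all
  note top = this
  show "affine_condition m a"
    unfolding affine_condition_def
  proof (intro allI impI)
    fix k assume "k \<le> m"
    then have "real_of_int (a k) = c + d * (real m - real k)"
      using *[of "m - k"] by simp
    also have "\<dots> = (real m - real k) * (c + d) - (real m - real k - 1) * c"
      by (simp add: algebra_simps)
    also have "\<dots> = real_of_int ((int m - int k) * a (m - 1) - (int m - int k - 1) * a m)"
      by (simp add: top del: One_nat_def)
    finally show "a k = (int m - int k) * a (m - 1) - (int m - int k - 1) * a m"
      by (simp only: of_int_eq_iff)
  qed
qed

lemma affine_condition_iff_slope:
  assumes "m \<ge> 1"
  shows "affine_condition m a \<longleftrightarrow>
    (\<exists>h::int. real_of_int h = real_of_int (a m - a 0) / real m \<and> (\<forall>k\<le>m. a k = a 0 + h * int k))"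
proof
  assume a: "affine_condition m a"
  \<comment> \<open>In an affine sequence the last increment is the common one.\<close>
  define h where "h = a m - a (m - 1)"
  have a_eq: "a k = a m - (int m - int k) * h" if "k \<le> m" for k
    using a that unfolding affine_condition_def h_def by (simp add: algebra_simps)
  have "a m - a 0 = h * int m"
    using a_eq[of 0] by simp
  then have "real_of_int (a m - a 0) = real_of_int h * real m"
    by (metis of_int_mult of_int_of_nat_eq)
  then have "real_of_int h = real_of_int (a m - a 0) / real m"
    using assms by (simp add: field_simps del: of_int_diff)
  moreover have "a k = a 0 + h * int k" if "k \<le> m" for k
    using a_eq[OF that] \<open>a m - a 0 = h * int m\<close> by (simp add: algebra_simps)
  ultimately show "\<exists>h::int. real_of_int h = real_of_int (a m - a 0) / real m \<and> (\<forall>k\<le>m. a k = a 0 + h * int k)"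
    by blast
next
  assume "\<exists>h::int. real_of_int h = real_of_int (a m - a 0) / real m \<and> (\<forall>k\<le>m. a k = a 0 + h * int k)"
  then obtain h where a_eq: "\<And>k. k \<le> m \<Longrightarrow> a k = a 0 + h * int k"
    by blast
  \<comment> \<open>Reversing the index moves the intercept to the top value and flips the sign of
    the slope.\<close>
  have "real_of_int (a (m - k)) = real_of_int (a 0 + h * int m) + real_of_int (- h) * real k" if "k \<le> m" for k
    using that by (subst a_eq) (auto simp: algebra_simps)
  then show "affine_condition m a"
    using affine_condition_iff_real[OF assms] by blast
qed

text \<open>With \<open>a (m - k)\<close> affine in \<open>k\<close>, the drift involves the
  sampling distribution only through its total mass and its mean.\<close>

lemma affine_condition_drift:
  assumes "m \<ge> 1" "m \<le> w + v" "affine_condition m a"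
  shows "(\<Sum>k\<le>m. real_of_int (a (m - k)) * sample_prob md m w v k)
    = real_of_int (a m) + real m * real_of_int (a (m - 1) - a m) * real w / real (w + v)"
proof -
  have "(\<Sum>k\<le>m. real_of_int (a (m - k)) * sample_prob md m w v k)
      = (\<Sum>k\<le>m. real_of_int (a m) * sample_prob md m w v k
          + real_of_int (a (m - 1) - a m) * (real k * sample_prob md m w v k))"
    by (intro sum.cong refl, subst affine_condition_of_int[OF assms(3)]) (auto simp: algebra_simps)
  also have "\<dots> = real_of_int (a m) + real_of_int (a (m - 1) - a m) * (real m * real w / real (w + v))"
    using assms by (simp only: sum.distrib sum_sample_prob sample_prob_mean flip: sum_distrib_left)
  finally show ?thesis
    by (simp add: mult_ac)
qed

text \<open>The mean of the sample is proportional to \<open>w\<close>, so an affine drift is also the drift of an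
  affine replacement sequence; independence then identifies the two.\<close>

lemma affine_condition_if_affine_drift:
  fixes \<alpha> \<beta> :: real
  assumes "m \<ge> 1" "m \<le> T" "S \<subseteq> {..T}" "m < card S"
    and drift: "\<And>w. w \<in> S \<Longrightarrow>
      real w + (\<Sum>k\<le>m. real_of_int (a (m - k)) * sample_prob md m w (T - w) k) = \<alpha> * real w + \<beta>"
  shows "affine_condition m a"
proof -
  \<comment> \<open>Chosen so that slope times sample mean, \<open>e * (m * w / T)\<close>, equals
    the required \<open>(\<alpha> - 1) * w\<close>.\<close>
  define e where "e = (\<alpha> - 1) * real T / real m"
  have "real_of_int (a (m - k)) - (\<beta> + e * real k) = 0" if "k \<le> m" for k
  proof (rule sample_prob_independent[where md = md and S = S and T = T and m = m])
    fix w assume "w \<in> S"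
    then have "w \<le> T"
      using assms(3) by auto
    have "(\<Sum>k\<le>m. (real_of_int (a (m - k)) - (\<beta> + e * real k)) * sample_prob md m w (T - w) k)
        = (\<Sum>k\<le>m. real_of_int (a (m - k)) * sample_prob md m w (T - w) k)
          - (\<beta> * (\<Sum>k\<le>m. sample_prob md m w (T - w) k)
             + e * (\<Sum>k\<le>m. real k * sample_prob md m w (T - w) k))"
      by (simp add: sum_distrib_left sum_subtractf sum.distrib algebra_simps)
    also have "\<dots> = (\<alpha> - 1) * real w + \<beta> - (\<beta> + e * (real m * real w / real T))"
      using drift[OF \<open>w \<in> S\<close>] \<open>w \<le> T\<close> assms(1,2)
      by (simp add: sum_sample_prob sample_prob_mean algebra_simps)
    also have "\<dots> = 0"
      using assms(1,2) by (simp add: e_def)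
    finally show "(\<Sum>k\<le>m. (real_of_int (a (m - k)) - (\<beta> + e * real k)) * sample_prob md m w (T - w) k) = 0" .
  qed (use assms that in auto)
  then show ?thesis
    using affine_condition_iff_real[OF \<open>m \<ge> 1\<close>] by (metis eq_iff_diff_eq_0)
qed

section \<open>Conditional expectations and almost sure behaviour of the urn process\<close>

context urn_process
begin

lemma space_draw_field [simp]: "space (draw_field M K n) = space M"
  by (simp add: draw_field_def space_measure_of_conv)

lemma sets_draw_field:
  "sets (draw_field M K n) = sigma_sets (space M) {K i -` A \<inter> space M | i A. 1 \<le> i \<and> i \<le> n}"
  unfolding draw_field_def by (intro sets_measure_of) auto

lemma subalgebra_draw_field: "subalgebra M (draw_field M K n)"
  unfolding subalgebra_def sets_draw_field
  by (auto intro!: sets.sigma_sets_subset measurable_sets[OF sample_measurable])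

sublocale draw_field: finite_measure_subalgebra M "draw_field M K n"
  by unfold_locales (rule subalgebra_draw_field)

lemma sample_measurable_draw_field:
  "1 \<le> i \<Longrightarrow> i \<le> n \<Longrightarrow> K i \<in> measurable (draw_field M K n) (count_space UNIV)"
  by (rule measurableI) (auto simp: sets_draw_field intro!: sigma_sets.Basic)

lemma balls_measurable_draw_field:
  assumes "i \<le> n"
  shows "balls m c x0 K i \<in> measurable (draw_field M K n) (count_space UNIV)"
  using assms
proof (induction i)
  case 0
  have "balls m c x0 K 0 = (\<lambda>_. int x0)"
    by auto
  then show ?case
    by simp
next
  case (Suc i)
  have [measurable]: "balls m c x0 K i \<in> measurable (draw_field M K n) (count_space UNIV)"
    "K (Suc i) \<in> measurable (draw_field M K n) (count_space UNIV)"
    using Suc sample_measurable_draw_field by auto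
  have "balls m c x0 K (Suc i) = (\<lambda>\<omega>. balls m c x0 K i \<omega> + c (m - K (Suc i) \<omega>))"
    by auto
  then show ?case
    by simp
qed

lemma balls_measurable: "balls m c x0 K n \<in> measurable M (count_space UNIV)"
  by (rule measurable_from_subalg[OF subalgebra_draw_field balls_measurable_draw_field[OF order_refl]])

lemma sample_event [measurable]: "1 \<le> n \<Longrightarrow> {\<omega> \<in> space M. K n \<omega> = k} \<in> sets M"
  using sample_measurable by measurable

text \<open>Since \<open>K (Suc n) \<omega> \<le> m\<close>, exactly one indicator is active. This
  makes the increment linear in the events whose conditional probabilities \<open>sample_law\<close>
  prescribes.\<close>

lemma balls_step:
  assumes "\<omega> \<in> space M"
  shows "real_of_int (balls m c x0 K (Suc n) \<omega>) = real_of_int (balls m c x0 K n \<omega>)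
    + (\<Sum>k\<le>m. real_of_int (c (m - k)) * indicat_real {\<omega> \<in> space M. K (Suc n) \<omega> = k} \<omega>)"
proof -
  have "(\<Sum>k\<le>m. real_of_int (c (m - k)) * indicat_real {\<omega> \<in> space M. K (Suc n) \<omega> = k} \<omega>)
      = (\<Sum>k\<le>m. if k = K (Suc n) \<omega> then real_of_int (c (m - k)) else 0)"
    using assms by (intro sum.cong) (auto simp: indicator_def)
  also have "\<dots> = real_of_int (c (m - K (Suc n) \<omega>))"
    using sample_le[of "Suc n" \<omega>] assms by simp
  finally show ?thesis
    by simp
qed

lemma integrable_sample_event:
  "1 \<le> n \<Longrightarrow> integrable M (indicat_real {\<omega> \<in> space M. K n \<omega> = k})"
  by (intro integrable_real_indicator sample_event) (auto simp: emeasure_eq_measure)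

lemma integrable_balls: "integrable M (\<lambda>\<omega>. real_of_int (balls m c x0 K n \<omega>))"
proof (induction n)
  case (Suc n)
  have "integrable M (\<lambda>\<omega>. real_of_int (balls m c x0 K n \<omega>)
      + (\<Sum>k\<le>m. real_of_int (c (m - k)) * indicat_real {\<omega> \<in> space M. K (Suc n) \<omega> = k} \<omega>))"
    by (intro Bochner_Integration.integrable_add Bochner_Integration.integrable_sum
        integrable_mult_right integrable_sample_event Suc) simp
  then show ?case
    by (rule iffD2[rotated]) (intro Bochner_Integration.integrable_cong refl balls_step)
qed simp

text \<open>The current count is measurable with respect to the past and passes through unchanged;
  linearity and \<open>sample_law\<close> evaluate the increment term by term.\<close>

lemma cond_exp_white_balls:
  "AE \<omega> in M. real_cond_exp M (draw_field M K n) (\<lambda>\<omega>. real_of_int (balls m a W0 K (Suc n) \<omega>)) \<omega>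
    = real_of_int (balls m a W0 K n \<omega>) + (\<Sum>k\<le>m. real_of_int (a (m - k)) *
        sample_prob md m (nat (balls m a W0 K n \<omega>)) (nat (balls m b B0 K n \<omega>)) k)"
proof -
  let ?F = "draw_field M K n"
  let ?W = "\<lambda>n \<omega>. real_of_int (balls m a W0 K n \<omega>)"
  let ?I = "\<lambda>k. indicat_real {\<omega> \<in> space M. K (Suc n) \<omega> = k}"
  let ?f = "\<lambda>k \<omega>. real_of_int (a (m - k)) * ?I k \<omega>"
  have int_f: "integrable M (?f k)" for k
    by (intro integrable_mult_right integrable_sample_event) simp
  have int_sum: "integrable M (\<lambda>\<omega>. \<Sum>k\<le>m. ?f k \<omega>)"
    by (intro Bochner_Integration.integrable_sum int_f)
  have "AE \<omega> in M. real_cond_exp M ?F (?W (Suc n)) \<omega>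
      = real_cond_exp M ?F (\<lambda>\<omega>. ?W n \<omega> + (\<Sum>k\<le>m. ?f k \<omega>)) \<omega>"
    by (intro draw_field.real_cond_exp_cong AE_I2 borel_measurable_integrable
        Bochner_Integration.integrable_add integrable_balls int_sum balls_step)
  moreover have "AE \<omega> in M. real_cond_exp M ?F (\<lambda>\<omega>. ?W n \<omega> + (\<Sum>k\<le>m. ?f k \<omega>)) \<omega>
      = real_cond_exp M ?F (?W n) \<omega> + real_cond_exp M ?F (\<lambda>\<omega>. \<Sum>k\<le>m. ?f k \<omega>) \<omega>"
    using integrable_balls int_sum by (rule draw_field.real_cond_exp_add)
  moreover have "AE \<omega> in M. real_cond_exp M ?F (?W n) \<omega> = ?W n \<omega>"
    using integrable_balls
    by (rule draw_field.real_cond_exp_F_meas)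
      (rule measurable_compose[OF balls_measurable_draw_field[OF order_refl]], simp)
  moreover have "AE \<omega> in M. real_cond_exp M ?F (\<lambda>\<omega>. \<Sum>k\<le>m. ?f k \<omega>) \<omega> = (\<Sum>k\<le>m. real_cond_exp M ?F (?f k) \<omega>)"
    using int_f by (rule draw_field.real_cond_exp_sum)
  moreover have "AE \<omega> in M. \<forall>k\<in>{..m}. real_cond_exp M ?F (?f k) \<omega> = real_of_int (a (m - k)) *
      sample_prob md m (nat (balls m a W0 K n \<omega>)) (nat (balls m b B0 K n \<omega>)) k"
  proof (rule AE_finite_allI)
    fix k assume "k \<in> {..m}"
    then have "AE \<omega> in M. real_cond_exp M ?F (?I k) \<omega>
        = sample_prob md m (nat (balls m a W0 K n \<omega>)) (nat (balls m b B0 K n \<omega>)) k"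
      using sample_law[of "Suc n" k] by simp
    moreover have "AE \<omega> in M. real_cond_exp M ?F (?f k) \<omega> = real_of_int (a (m - k)) * real_cond_exp M ?F (?I k) \<omega>"
      using integrable_sample_event[of "Suc n" k] by (intro draw_field.real_cond_exp_cmult) auto
    ultimately show "AE \<omega> in M. real_cond_exp M ?F (?f k) \<omega> = real_of_int (a (m - k)) *
        sample_prob md m (nat (balls m a W0 K n \<omega>)) (nat (balls m b B0 K n \<omega>)) k"
      by eventually_elim simp
  qed simp
  ultimately show ?thesis
    by eventually_elim simp
qed

text \<open>The event \<open>?Z\<close> that outcome \<open>k\<close> has conditional probability
  zero belongs to the past. Hence the probability of \<open>?Z\<close> together with
  \<open>K (Suc n) = k\<close> is the integral over \<open>?Z\<close> of that conditional
  probability, which is zero.\<close>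

lemma AE_sample_prob_pos:
  "AE \<omega> in M. sample_prob md m (nat (balls m a W0 K n \<omega>)) (nat (balls m b B0 K n \<omega>)) (K (Suc n) \<omega>) > 0"
proof -
  let ?p = "\<lambda>k \<omega>. sample_prob md m (nat (balls m a W0 K n \<omega>)) (nat (balls m b B0 K n \<omega>)) k"
  \<comment> \<open>The random index is replaced by a fixed \<open>k\<close>; finitely many
    exceptional null sets can be united.\<close>
  have "AE \<omega> in M. \<forall>k\<in>{..m}. K (Suc n) \<omega> = k \<longrightarrow> ?p k \<omega> > 0"
  proof (rule AE_finite_allI)
    fix k assume "k \<in> {..m}"
    let ?I = "{\<omega> \<in> space M. K (Suc n) \<omega> = k}"
    let ?Z = "{\<omega> \<in> space M. ?p k \<omega> = 0}"
    have [measurable]: "balls m a W0 K n \<in> measurable (draw_field M K n) (count_space UNIV)"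
      "balls m b B0 K n \<in> measurable (draw_field M K n) (count_space UNIV)"
      by (simp_all add: balls_measurable_draw_field)
    have Z: "?Z \<in> sets (draw_field M K n)"
    proof -
      have "{\<omega> \<in> space (draw_field M K n). ?p k \<omega> = 0} \<in> sets (draw_field M K n)"
        by measurable
      then show ?thesis
        by simp
    qed
    then have Z': "?Z \<in> sets M"
      using subalgebra_draw_field by (auto simp: subalgebra_def)
    have I: "?I \<in> sets M"
      by (rule sample_event) simp
    have law: "AE \<omega> in M. real_cond_exp M (draw_field M K n) (indicat_real ?I) \<omega> = ?p k \<omega>"
      using sample_law[of "Suc n" k] \<open>k \<in> {..m}\<close> by simp
    have "measure M (?Z \<inter> ?I) = (\<integral>\<omega>\<in>?Z. indicat_real ?I \<omega> \<partial>M)"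
      using Z' I by (simp add: set_lebesgue_integral_def flip: indicator_inter_arith)
    also have "\<dots> = (\<integral>\<omega>\<in>?Z. real_cond_exp M (draw_field M K n) (indicat_real ?I) \<omega> \<partial>M)"
      using Z integrable_sample_event[of "Suc n" k] by (intro draw_field.real_cond_exp_intA) auto
    also have "\<dots> = 0"
      unfolding set_lebesgue_integral_def
      by (rule integral_eq_zero_AE) (use law in eventually_elim, simp add: indicator_def)
    finally have "AE \<omega> in M. \<omega> \<notin> ?Z \<inter> ?I"
      using Z' I by (intro AE_not_in) (simp add: null_sets_def emeasure_eq_measure)
    then show "AE \<omega> in M. K (Suc n) \<omega> = k \<longrightarrow> ?p k \<omega> > 0"
      using AE_space
      by eventually_elim (use sample_prob_nonneg[of md m] in \<open>auto simp: less_le\<close>)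
  qed simp
  then show ?thesis
    using AE_space by eventually_elim (use sample_le in auto)
qed

text \<open>Transfers tenability, a combinatorial statement about \<open>reachable\<close>, to
  almost every path.\<close>

lemma AE_reachable: "AE \<omega> in M. reachable md m a b W0 B0 (balls m a W0 K n \<omega>) (balls m b B0 K n \<omega>)"
proof (induction n)
  case (Suc n)
  then show ?case
    using AE_sample_prob_pos[of n] AE_space
    by eventually_elim (use sample_le in \<open>auto intro: reachable.draw\<close>)
qed (simp add: reachable.init)

text \<open>An atom of positive probability cannot lie in a null set. This turns almost sure
  identities into deterministic ones at every attained value.\<close>

lemma white_values_AE:
  assumes "AE \<omega> in M. P (balls m a W0 K n \<omega>)" "x \<in> white_values m a W0 M K n"
  shows "P x"
proof (rule ccontr)
  assume "\<not> P x"
  have [measurable]: "balls m a W0 K n \<in> measurable M (count_space UNIV)"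
    by (rule balls_measurable)
  have "AE \<omega> in M. \<not> (balls m a W0 K n \<omega> = x)"
    using assms(1) by eventually_elim (use \<open>\<not> P x\<close> in auto)
  then have "measure M {\<omega> \<in> space M. balls m a W0 K n \<omega> = x} = 0"
    by (subst (asm) AE_iff_measurable[OF _ refl]) (auto simp: measure_def)
  then show False
    using assms(2) by (simp add: white_values_def)
qed

end

section \<open>Balanced tenable urns: affine recursion against affine drift\<close>

locale balanced_urn_process = urn_process md m a b W0 B0 M K
  for md m a b W0 B0 and M :: "'a measure" and K +
  fixes \<sigma> :: int
  assumes sample_size: "m \<ge> 1"
    and balanced: "k \<le> m \<Longrightarrow> a k + b k = \<sigma>"
    and balance_nonneg: "\<sigma> \<ge> 0"
    and start: "W0 + B0 \<ge> m"
    and tenable: "tenable md m a b W0 B0"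
begin

text \<open>A natural number, so that it can enter \<open>sample_prob\<close>;
  \<open>nat \<sigma>\<close> loses nothing because \<open>\<sigma> \<ge> 0\<close>.\<close>

definition total :: "nat \<Rightarrow> nat" where
  "total n = W0 + B0 + nat \<sigma> * n"

lemma total_ge: "m \<le> total n"
  using start by (simp add: total_def)

lemma total_balls_eq: "total_balls \<sigma> (W0 + B0) n = real (total n)"
  using balance_nonneg by (simp add: total_balls_def total_def)

lemma balls_add:
  assumes "\<omega> \<in> space M"
  shows "balls m a W0 K n \<omega> + balls m b B0 K n \<omega> = int (total n)"
proof (induction n)
  case (Suc n)
  have "a (m - K (Suc n) \<omega>) + b (m - K (Suc n) \<omega>) = \<sigma>"
    by (rule balanced) simp
  then show ?case
    using Suc balance_nonneg by (simp add: total_def algebra_simps)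
qed (simp add: total_def)

text \<open>Balance fixes the black count as \<open>total n - w\<close>, which makes the expected
  increment a function of \<open>w\<close> alone at each time.\<close>

definition drift :: "nat \<Rightarrow> nat \<Rightarrow> real" where
  "drift n w = (\<Sum>k\<le>m. real_of_int (a (m - k)) * sample_prob md m w (total n - w) k)"

text \<open>Reachability and tenability make both counts nonnegative, so the conversions by
  \<open>nat\<close> in \<open>sample_law\<close> are faithful and the black count is the total
  minus the white one.\<close>

lemma AE_cond_exp:
  "AE \<omega> in M. 0 \<le> balls m a W0 K n \<omega> \<and> balls m a W0 K n \<omega> \<le> int (total n) \<and>
    real_cond_exp M (draw_field M K n) (\<lambda>\<omega>. real_of_int (balls m a W0 K (Suc n) \<omega>)) \<omega>
      = real_of_int (balls m a W0 K n \<omega>) + drift n (nat (balls m a W0 K n \<omega>))"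
  using cond_exp_white_balls[of n] AE_reachable[of n] AE_space
proof eventually_elim
  case (elim \<omega>)
  have "0 \<le> balls m a W0 K n \<omega>" "0 \<le> balls m b B0 K n \<omega>"
    using elim(2) tenable by (auto simp: tenable_def)
  moreover have "balls m b B0 K n \<omega> = int (total n) - balls m a W0 K n \<omega>"
    using balls_add[OF elim(3), of n] by simp
  ultimately show ?case
    using elim(1) by (simp add: drift_def nat_diff_distrib)
qed

lemma white_values_bounds:
  assumes "x \<in> white_values m a W0 M K n"
  shows "0 \<le> x \<and> x \<le> int (total n)"
  by (rule white_values_AE[OF _ assms], use AE_cond_exp[of n] in eventually_elim) simp

lemma affine_recursion_drift:
  assumes "affine_recursion m a W0 M K \<alpha> \<beta>" "x \<in> white_values m a W0 M K n"
  shows "real_of_int x + drift n (nat x) = \<alpha> (Suc n) * real_of_int x + \<beta> (Suc n)"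
proof (rule white_values_AE[OF _ assms(2)])
  have "AE \<omega> in M. real_cond_exp M (draw_field M K n) (\<lambda>\<omega>. real_of_int (balls m a W0 K (Suc n) \<omega>)) \<omega>
      = \<alpha> (Suc n) * real_of_int (balls m a W0 K n \<omega>) + \<beta> (Suc n)"
    using assms(1)[unfolded affine_recursion_def, rule_format, of "Suc n"] by simp
  then show "AE \<omega> in M. real_of_int (balls m a W0 K n \<omega>) + drift n (nat (balls m a W0 K n \<omega>))
      = \<alpha> (Suc n) * real_of_int (balls m a W0 K n \<omega>) + \<beta> (Suc n)"
    using AE_cond_exp[of n] by eventually_elim simp
qed

lemma initial_white_value: "int W0 \<in> white_values m a W0 M K 0"
  by (simp add: white_values_def prob_space)

lemma affine_drift:
  assumes "affine_condition m a" "w \<le> total n"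
  shows "real w + drift n w = affine_slope m a \<sigma> (W0 + B0) (Suc n) * real w + real_of_int (a m)"
proof -
  have "drift n w = real_of_int (a m) + real m * real_of_int (a (m - 1) - a m) * real w / real (total n)"
    unfolding drift_def
    using affine_condition_drift[OF sample_size _ assms(1), of w "total n - w" md] total_ge[of n] assms(2)
    by simp
  moreover have "real (total n) > 0"
    using total_ge[of n] sample_size by simp
  ultimately show ?thesis
    unfolding affine_slope_def total_balls_eq diff_Suc_1 by (simp add: field_simps)
qed

lemma affine_recursion_if_affine_condition:
  assumes "affine_condition m a"
  shows "affine_recursion m a W0 M K (affine_slope m a \<sigma> (W0 + B0)) (\<lambda>_. real_of_int (a m))"
  unfolding affine_recursion_def
proof (intro allI impI)
  fix n :: nat assume "n \<ge> 1"
  then obtain n' where n: "n = Suc n'"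
    by (cases n) auto
  show "AE \<omega> in M. real_cond_exp M (draw_field M K (n - 1)) (\<lambda>\<omega>. real_of_int (balls m a W0 K n \<omega>)) \<omega>
      = affine_slope m a \<sigma> (W0 + B0) n * real_of_int (balls m a W0 K (n - 1) \<omega>) + real_of_int (a m)"
    using AE_cond_exp[of n']
  proof eventually_elim
    case (elim \<omega>)
    then show ?case
      using affine_drift[OF assms, of "nat (balls m a W0 K n' \<omega>)" n'] by (simp add: n nat_le_iff)
  qed
qed

text \<open>All values attained at one time \<open>n\<close> share the total and the coefficients at
  \<open>Suc n\<close>, so they supply more than \<open>m\<close> points at which a single drift
  function is affine.\<close>

lemma affine_condition_if_affine_recursion:
  assumes "affine_recursion m a W0 M K \<alpha> \<beta>" "card (white_values m a W0 M K n) > m"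
  shows "affine_condition m a"
proof (rule affine_condition_if_affine_drift[OF sample_size total_ge])
  let ?S = "nat ` white_values m a W0 M K n"
  show "?S \<subseteq> {..total n}"
    using white_values_bounds by force
  have "inj_on nat (white_values m a W0 M K n)"
    using white_values_bounds by (intro inj_onI) (metis nat_0_le)
  then show "m < card ?S"
    using assms(2) by (simp add: card_image)
  show "real w + (\<Sum>k\<le>m. real_of_int (a (m - k)) * sample_prob md m w (total n - w) k)
      = \<alpha> (Suc n) * real w + \<beta> (Suc n)" if "w \<in> ?S" for w
    using that affine_recursion_drift[OF assms(1)] white_values_bounds
    by (force simp: drift_def)
qed

text \<open>Two distinct attained values determine an affine function.\<close>

lemma affine_recursion_unique:
  assumes "affine_condition m a" "affine_recursion m a W0 M K \<alpha> \<beta>" "n \<ge> 1"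
    and card: "card (white_values m a W0 M K (n - 1)) > 1"
  shows "\<alpha> n = affine_slope m a \<sigma> (W0 + B0) n \<and> \<beta> n = real_of_int (a m)"
proof -
  obtain n' where n: "n = Suc n'"
    using \<open>n \<ge> 1\<close> by (cases n) auto
  obtain x y where xy: "x \<in> white_values m a W0 M K n'" "y \<in> white_values m a W0 M K n'" "x \<noteq> y"
    using card by (metis n diff_Suc_1 card_le_Suc0_iff_eq card.infinite not_less One_nat_def zero_le)
  have eq: "\<alpha> n * real_of_int z + \<beta> n = affine_slope m a \<sigma> (W0 + B0) n * real_of_int z + real_of_int (a m)"
    if "z \<in> white_values m a W0 M K n'" for z
    using affine_recursion_drift[OF assms(2) that] affine_drift[OF assms(1), of "nat z" n']
      white_values_bounds[OF that] by (simp add: n nat_le_iff)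
  have "(\<alpha> n - affine_slope m a \<sigma> (W0 + B0) n) * (real_of_int x - real_of_int y) = 0"
    using eq[OF xy(1)] eq[OF xy(2)] by (simp add: algebra_simps)
  then have "\<alpha> n = affine_slope m a \<sigma> (W0 + B0) n"
    using xy(3) by simp
  then show ?thesis
    using eq[OF xy(1)] by simp
qed

end

text \<open>The first draw suffices: the urn started from \<open>w\<close> has the sure value
  \<open>w\<close> at time zero, and letting \<open>w\<close> run through \<open>{..T}\<close> gives
  \<open>T + 1 > m\<close> points with the same total and the same coefficients
  \<open>\<alpha> 1\<close>, \<open>\<beta> 1\<close>.\<close>

lemma affine_condition_if_common_affine_recursion:
  assumes "m \<le> T" and urns: "\<And>w. w \<le> T \<Longrightarrow> balanced_urn_process md m a b w (T - w) (M w) (K w) \<sigma>"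
    and recursion: "\<And>w. w \<le> T \<Longrightarrow> affine_recursion m a w (M w) (K w) \<alpha> \<beta>"
  shows "affine_condition m a"
proof (rule affine_condition_if_affine_drift[OF _ assms(1) order_refl])
  show "m \<ge> 1"
    using urns[of 0] by (simp add: balanced_urn_process_def balanced_urn_process_axioms_def)
  show "real w + (\<Sum>k\<le>m. real_of_int (a (m - k)) * sample_prob md m w (T - w) k) = \<alpha> 1 * real w + \<beta> 1"
    if "w \<in> {..T}" for w
  proof -
    have "w \<le> T"
      using that by simp
    interpret urn: balanced_urn_process md m a b w "T - w" "M w" "K w" \<sigma>
      by (rule urns) fact
    show ?thesis
      using urn.affine_recursion_drift[OF recursion[OF \<open>w \<le> T\<close>] urn.initial_white_value] \<open>w \<le> T\<close>
      by (simp add: urn.drift_def urn.total_def)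
  qed
qed (use assms(1) in simp)

theorem proposition1:
  fixes md :: sampling_model and m :: nat and a b :: "nat \<Rightarrow> int" and \<sigma> :: int
    and W0 B0 :: nat and M :: "'a measure" and K :: "nat \<Rightarrow> 'a \<Rightarrow> nat"
  assumes "m \<ge> 1"
    and balanced: "\<And>k. k \<le> m \<Longrightarrow> a k + b k = \<sigma>"
    and "\<sigma> \<ge> 0"
    and "W0 + B0 \<ge> m"
    and "tenable md m a b W0 B0"
    and "urn_process md m a b W0 B0 M K"
  shows
    \<comment> \<open>characterisation for the given urn; the premise excludes degenerate urns
        (such as \<open>W0 = 0\<close>, \<open>a m = 0\<close>), for which the recursion does not constrain \<open>a\<close>\<close>
    "((\<exists>n. card (white_values m a W0 M K n) > m) \<longrightarrow>
        ((\<exists>\<alpha> \<beta>. affine_recursion m a W0 M K \<alpha> \<beta>) \<longleftrightarrow> affine_condition m a))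
    \<comment> \<open>the same without that premise, when the recursion is required, with common \<open>\<alpha>\<close> and \<open>\<beta>\<close>,
        from all initial compositions of \<open>W0 + B0\<close> balls\<close>
    \<and> (\<forall>(M' :: nat \<Rightarrow> 'b measure) K'.
         (\<forall>w \<le> W0 + B0. tenable md m a b w (W0 + B0 - w)
             \<and> urn_process md m a b w (W0 + B0 - w) (M' w) (K' w)) \<longrightarrow>
         ((\<exists>\<alpha> \<beta>. \<forall>w \<le> W0 + B0. affine_recursion m a w (M' w) (K' w) \<alpha> \<beta>)
            \<longleftrightarrow> affine_condition m a))
    \<comment> \<open>equivalent form of the condition\<close>
    \<and> (affine_condition m a \<longleftrightarrow>
         (\<exists>h::int. real_of_int h = real_of_int (a m - a 0) / real m
            \<and> (\<forall>k\<le>m. a k = a 0 + h * int k)))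
    \<comment> \<open>the sequences, which are unique wherever \<open>W\<close> at time \<open>n - 1\<close> is not almost surely constant\<close>
    \<and> (affine_condition m a \<longrightarrow>
         affine_recursion m a W0 M K (affine_slope m a \<sigma> (W0 + B0)) (\<lambda>_. real_of_int (a m))
         \<and> (\<forall>\<alpha> \<beta>. affine_recursion m a W0 M K \<alpha> \<beta> \<longrightarrow>
              (\<forall>n\<ge>1. card (white_values m a W0 M K (n - 1)) > 1 \<longrightarrow>
                 \<alpha> n = affine_slope m a \<sigma> (W0 + B0) n \<and> \<beta> n = real_of_int (a m))))"
proof (intro conjI)
  interpret balanced_urn_process md m a b W0 B0 M K \<sigma>
    using assms by (simp add: balanced_urn_process_def balanced_urn_process_axioms_def)
  show "(\<exists>n. card (white_values m a W0 M K n) > m) \<longrightarrow>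
      ((\<exists>\<alpha> \<beta>. affine_recursion m a W0 M K \<alpha> \<beta>) \<longleftrightarrow> affine_condition m a)"
    using affine_condition_if_affine_recursion affine_recursion_if_affine_condition by blast
  show "affine_condition m a \<longleftrightarrow>
      (\<exists>h::int. real_of_int h = real_of_int (a m - a 0) / real m \<and> (\<forall>k\<le>m. a k = a 0 + h * int k))"
    by (rule affine_condition_iff_slope[OF \<open>m \<ge> 1\<close>])
  show "affine_condition m a \<longrightarrow>
      affine_recursion m a W0 M K (affine_slope m a \<sigma> (W0 + B0)) (\<lambda>_. real_of_int (a m))
      \<and> (\<forall>\<alpha> \<beta>. affine_recursion m a W0 M K \<alpha> \<beta> \<longrightarrow>
           (\<forall>n\<ge>1. card (white_values m a W0 M K (n - 1)) > 1 \<longrightarrow>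
              \<alpha> n = affine_slope m a \<sigma> (W0 + B0) n \<and> \<beta> n = real_of_int (a m)))"
    using affine_recursion_if_affine_condition affine_recursion_unique by blast
next
  show "\<forall>(M' :: nat \<Rightarrow> 'b measure) K'.
      (\<forall>w \<le> W0 + B0. tenable md m a b w (W0 + B0 - w)
          \<and> urn_process md m a b w (W0 + B0 - w) (M' w) (K' w)) \<longrightarrow>
      ((\<exists>\<alpha> \<beta>. \<forall>w \<le> W0 + B0. affine_recursion m a w (M' w) (K' w) \<alpha> \<beta>) \<longleftrightarrow> affine_condition m a)"
  proof (intro allI impI)
    fix M' :: "nat \<Rightarrow> 'b measure" and K'
    assume "\<forall>w \<le> W0 + B0. tenable md m a b w (W0 + B0 - w)
        \<and> urn_process md m a b w (W0 + B0 - w) (M' w) (K' w)"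
    then have urns: "balanced_urn_process md m a b w (W0 + B0 - w) (M' w) (K' w) \<sigma>" if "w \<le> W0 + B0" for w
      using that assms by (simp add: balanced_urn_process_def balanced_urn_process_axioms_def)
    \<comment> \<open>The slope depends on the initial composition only through its size, so one
      pair of sequences serves every \<open>w\<close>.\<close>
    have "affine_recursion m a w (M' w) (K' w) (affine_slope m a \<sigma> (W0 + B0)) (\<lambda>_. real_of_int (a m))"
      if "affine_condition m a" "w \<le> W0 + B0" for w
      using balanced_urn_process.affine_recursion_if_affine_condition[OF urns[OF that(2)] that(1)] that(2)
      by simp
    then show "(\<exists>\<alpha> \<beta>. \<forall>w \<le> W0 + B0. affine_recursion m a w (M' w) (K' w) \<alpha> \<beta>) \<longleftrightarrow> affine_condition m a"
      using affine_condition_if_common_affine_recursion[OF \<open>W0 + B0 \<ge> m\<close> urns] by blast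
  qed
qed

end
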